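(* For any structure $\mathcal{M}$ in a language $\Sigma_1$ of unary predicates the tetrad $$\deg_4(\mathcal{M})=\left(\deg^{\exists\text{-}\mathrm{sem}}_{\mathrm{rig}}(\mathcal{M}),\deg^{\exists\text{-}\mathrm{synt}}_{\mathrm{rig}}(\mathcal{M}),\deg^{\forall\text{-}\mathrm{sem}}_{\mathrm{rig}}(\mathcal{M}),\deg^{\forall\text{-}\mathrm{synt}}_{\mathrm{rig}}(\mathcal{M})\right)$$ has one of the following possibilities: 1) $(0,0,0,0)$, if $\mathcal{M}$ is both semantically and syntactically rigid; 2) $(m,m,n,n)$, if $\mathcal{M}$ is finite with $n+1$ elements and it is not semantically rigid, that is, not syntactically rigid, with some minimal $m$-element set $A\subset M$, $1\leq m\leq n$, producing $\mathrm{dcl}(A)=M$; 3) $(0,\nu,0,\infty)$, if $\mathcal{M}$ is infinite, semantically rigid but not syntactically rigid, with $1\leq\nu\leq\infty$; 4) $(\mu,\nu,\infty,\infty)$, if $\mathcal{M}$ is infinite and both not semantically rigid and not syntactically rigid, with $1\leq\mu\leq\nu\leq\infty$.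
   Context: The universe of $\mathcal{M}$ is denoted $M$. For $A\subseteq M$, $\mathrm{dcl}(A)$ is the set of $b\in M$ such that $\{b\}$ is definable in $\mathcal{M}$ by a first-order formula with parameters from $A$. The structure $\mathcal{M}$ is semantically $A$-rigid if the only automorphism of $\mathcal{M}$ fixing $A$ pointwise is the identity; it is syntactically $A$-rigid if $M=\mathrm{dcl}(A)$. "Semantically rigid" and "syntactically rigid" mean the case $A=\emptyset$. For $n\in\omega$, $\mathcal{M}$ is $\forall$-semantically / $\forall$-syntactically (respectively $\exists$-semantically / $\exists$-syntactically) $n$-rigid if it is semantically / syntactically $A$-rigid for every (respectively some) $A\subseteq M$ with $|A|=n$. For $Q\in\{\forall,\exists\}$, $\deg^{Q\text{-}\mathrm{sem}}_{\mathrm{rig}}(\mathcal{M})$ (respectively $\deg^{Q\text{-}\mathrm{synt}}_{\mathrm{rig}}(\mathcal{M})$) is the least $n\in\omega$ such that $\mathcal{M}$ is $Q$-semantically (respectively $Q$-syntactically) $n$-rigid, and is $\infty$ if no such $n$ exists. The order on $\omega\cup\{\infty\}$ has $n<\infty$ for all $n\in\omega$. *)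

theory Defs
  imports Main "HOL-Library.Extended_Nat"
begin

text \<open>Structures in a language of unary predicates. The language is a set of symbols rather
  than a whole type, so that the empty language is included.\<close>

record ('a, 'p) unary_struct =
  univ :: "'a set"
  lang :: "'p set"
  interp :: "'p \<Rightarrow> 'a set"

definition unary_structure :: "('a, 'p) unary_struct \<Rightarrow> bool" where
  "unary_structure M \<longleftrightarrow> univ M \<noteq> {} \<and> (\<forall>p\<in>lang M. interp M p \<subseteq> univ M)"

text \<open>First-order formulas with equality; variables are natural numbers.\<close>

datatype 'p fm =
    Eq nat nat
  | Pred 'p nat
  | Neg "'p fm"
  | Conj "'p fm" "'p fm"
  | Ex nat "'p fm"

primrec fv :: "'p fm \<Rightarrow> nat set" where
  "fv (Eq x y) = {x, y}"
| "fv (Pred p x) = {x}"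
| "fv (Neg \<phi>) = fv \<phi>"
| "fv (Conj \<phi> \<psi>) = fv \<phi> \<union> fv \<psi>"
| "fv (Ex x \<phi>) = fv \<phi> - {x}"

primrec sat :: "('a, 'p) unary_struct \<Rightarrow> (nat \<Rightarrow> 'a) \<Rightarrow> 'p fm \<Rightarrow> bool" where
  "sat M e (Eq x y) \<longleftrightarrow> e x = e y"
| "sat M e (Pred p x) \<longleftrightarrow> e x \<in> interp M p"
| "sat M e (Neg \<phi>) \<longleftrightarrow> \<not> sat M e \<phi>"
| "sat M e (Conj \<phi> \<psi>) \<longleftrightarrow> sat M e \<phi> \<and> sat M e \<psi>"
| "sat M e (Ex x \<phi>) \<longleftrightarrow> (\<exists>a\<in>univ M. sat M (e(x := a)) \<phi>)"

text \<open>Variable 0 ranges over the defined set; every other free variable is a slot for a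
  parameter, whose value under the assignment must lie in A. The set of predicate symbols
  occurring in a formula is given by the datatype's set function.\<close>

definition definable :: "('a, 'p) unary_struct \<Rightarrow> 'a set \<Rightarrow> 'a set \<Rightarrow> bool" where
  "definable M A X \<longleftrightarrow>
     (\<exists>\<phi> e. set_fm \<phi> \<subseteq> lang M \<and> (\<forall>v\<in>fv \<phi> - {0}. e v \<in> A) \<and>
        X = {x \<in> univ M. sat M (e(0 := x)) \<phi>})"

definition dcl :: "('a, 'p) unary_struct \<Rightarrow> 'a set \<Rightarrow> 'a set" where
  "dcl M A = {b \<in> univ M. definable M A {b}}"

definition automorphism :: "('a, 'p) unary_struct \<Rightarrow> ('a \<Rightarrow> 'a) \<Rightarrow> bool" where
  "automorphism M f \<longleftrightarrow>
     bij_betw f (univ M) (univ M) \<and>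
     (\<forall>p\<in>lang M. \<forall>x\<in>univ M. f x \<in> interp M p \<longleftrightarrow> x \<in> interp M p)"

definition sem_rigid_over :: "('a, 'p) unary_struct \<Rightarrow> 'a set \<Rightarrow> bool" where
  "sem_rigid_over M A \<longleftrightarrow>
     (\<forall>f. automorphism M f \<and> (\<forall>a\<in>A. f a = a) \<longrightarrow> (\<forall>x\<in>univ M. f x = x))"

definition synt_rigid_over :: "('a, 'p) unary_struct \<Rightarrow> 'a set \<Rightarrow> bool" where
  "synt_rigid_over M A \<longleftrightarrow> univ M = dcl M A"

abbreviation sem_rigid :: "('a, 'p) unary_struct \<Rightarrow> bool" where
  "sem_rigid M \<equiv> sem_rigid_over M {}"

abbreviation synt_rigid :: "('a, 'p) unary_struct \<Rightarrow> bool" where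
  "synt_rigid M \<equiv> synt_rigid_over M {}"

text \<open>In the following, finiteness of A is explicit because infinite sets have card 0.\<close>

definition forall_sem_rigid :: "('a, 'p) unary_struct \<Rightarrow> nat \<Rightarrow> bool" where
  "forall_sem_rigid M n \<longleftrightarrow> (\<forall>A\<subseteq>univ M. finite A \<and> card A = n \<longrightarrow> sem_rigid_over M A)"

definition exists_sem_rigid :: "('a, 'p) unary_struct \<Rightarrow> nat \<Rightarrow> bool" where
  "exists_sem_rigid M n \<longleftrightarrow> (\<exists>A\<subseteq>univ M. finite A \<and> card A = n \<and> sem_rigid_over M A)"

definition forall_synt_rigid :: "('a, 'p) unary_struct \<Rightarrow> nat \<Rightarrow> bool" where
  "forall_synt_rigid M n \<longleftrightarrow> (\<forall>A\<subseteq>univ M. finite A \<and> card A = n \<longrightarrow> synt_rigid_over M A)"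

definition exists_synt_rigid :: "('a, 'p) unary_struct \<Rightarrow> nat \<Rightarrow> bool" where
  "exists_synt_rigid M n \<longleftrightarrow> (\<exists>A\<subseteq>univ M. finite A \<and> card A = n \<and> synt_rigid_over M A)"

definition least_or_infinity :: "(nat \<Rightarrow> bool) \<Rightarrow> enat" where
  "least_or_infinity P = (if \<exists>n. P n then enat (LEAST n. P n) else \<infinity>)"

definition deg4 :: "('a, 'p) unary_struct \<Rightarrow> enat \<times> enat \<times> enat \<times> enat" where
  "deg4 M =
     (least_or_infinity (exists_sem_rigid M), least_or_infinity (exists_synt_rigid M),
      least_or_infinity (forall_sem_rigid M), least_or_infinity (forall_synt_rigid M))"

end

theory Submission
  imports Defs "HOL-Combinatorics.Transposition"
begin

text \<open>
  A unary language sees an element only through the predicates that it satisfies, so both kinds of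
  rigidity can be read off the sets cell M P b of elements that satisfy the same
  predicates from P as b. A transposition of two elements of a common cell respects
  all predicates in P. It is thus an automorphism when P is the whole language, and it
  preserves the truth of any one formula when P is the finite set of predicates in that
  formula. This yields two purely combinatorial criteria
  (\<open>sem_rigid_over_iff\<close> and \<open>synt_rigid_over_iff\<close>):

  \<^item> M is semantically rigid over A iff two distinct elements outside A never
    satisfy exactly the same predicates;

  \<^item> M is syntactically rigid over A iff every b outside A is isolated by
    finitely many predicates, up to finitely many elements of A.

  Syntactic rigidity over A therefore implies semantic rigidity over A. Conversely, if
  b has a finite cell for some finite set of predicates, then finitely many further
  predicates separate b from everything in that cell that can be separated from it at all
  (\<open>finite_cell_stabilizes\<close>). For finite structures the two notions hence coincide, and the tetrad
  has the form (m, m, n, n).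

  The universal degrees come from choosing parameters badly. If two elements have the same
  predicates, every set that avoids both of them is semantically non-rigid; this gives the value
  \<infinity> for infinite structures and excludes all sizes below n for structures with
  n + 1 elements. If M is semantically but not syntactically rigid, some element b has
  only infinite cells for finite sets of predicates. Such a b lies in dcl(A) only when it lies
  in A, so its avoidance defeats syntactic rigidity over sets of every finite size.
\<close>

section \<open>Cells and transpositions\<close>

definition cell :: "('a, 'p) unary_struct \<Rightarrow> 'p set \<Rightarrow> 'a \<Rightarrow> 'a set" where
  "cell M P b = {x \<in> univ M. \<forall>p\<in>P. x \<in> interp M p \<longleftrightarrow> b \<in> interp M p}"

lemma cell_antimono: "P \<subseteq> Q \<Longrightarrow> cell M Q b \<subseteq> cell M P b"
  by (auto simp: cell_def)

lemma finite_fv: "finite (fv \<phi>)"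
  by (induction \<phi>) auto

lemma finite_set_fm: "finite (set_fm \<phi>)"
  by (induction \<phi>) auto

lemma sat_cong: "(\<And>v. v \<in> fv \<phi> \<Longrightarrow> e v = e' v) \<Longrightarrow> sat M e \<phi> \<longleftrightarrow> sat M e' \<phi>"
proof (induction \<phi> arbitrary: e e')
  case (Ex x \<phi>)
  have "sat M (e(x := a)) \<phi> \<longleftrightarrow> sat M (e'(x := a)) \<phi>" for a
    by (rule Ex.IH) (use Ex.prems in auto)
  then show ?case by simp
next
  case (Conj \<phi> \<psi>)
  have "sat M e \<phi> \<longleftrightarrow> sat M e' \<phi>" "sat M e \<psi> \<longleftrightarrow> sat M e' \<psi>"
    by (rule Conj.IH; use Conj.prems in auto)+
  then show ?case by simp
next
  case (Neg \<phi>)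
  have "sat M e \<phi> \<longleftrightarrow> sat M e' \<phi>"
    by (rule Neg.IH) (use Neg.prems in auto)
  then show ?case by simp
qed auto

lemma transpose_in_univ_iff:
  assumes "b \<in> univ M" "c \<in> univ M"
  shows "transpose b c x \<in> univ M \<longleftrightarrow> x \<in> univ M"
  using assms by (auto simp: transpose_def)

lemma transpose_in_interp_iff:
  assumes "c \<in> cell M P b" "p \<in> P"
  shows "transpose b c x \<in> interp M p \<longleftrightarrow> x \<in> interp M p"
  using assms by (auto simp: transpose_def cell_def)

text \<open>Only the predicates that occur in the formula matter, so b and c may well be
  separated by other predicates of the language.\<close>

lemma sat_transpose:
  assumes "b \<in> univ M" "c \<in> cell M P b" "set_fm \<phi> \<subseteq> P"
  shows "sat M (transpose b c \<circ> e) \<phi> \<longleftrightarrow> sat M e \<phi>"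
  using assms(3)
proof (induction \<phi> arbitrary: e)
  case (Eq x y)
  then show ?case by (simp, metis transpose_involutory)
next
  case (Pred p x)
  then show ?case using transpose_in_interp_iff[OF assms(2)] by simp
next
  case (Ex x \<phi>)
  let ?t = "transpose b c"
  have c: "c \<in> univ M"
    using assms(2) by (simp add: cell_def)
  have IH: "sat M ((?t \<circ> e)(x := ?t a)) \<phi> \<longleftrightarrow> sat M (e(x := a)) \<phi>" for a
  proof -
    have "(?t \<circ> e)(x := ?t a) = ?t \<circ> e(x := a)"
      by auto
    moreover have "sat M (?t \<circ> e(x := a)) \<phi> \<longleftrightarrow> sat M (e(x := a)) \<phi>"
      by (rule Ex.IH) (use Ex.prems in simp)
    ultimately show ?thesis
      by (simp only:)
  qed
  have "(\<exists>a\<in>univ M. sat M ((?t \<circ> e)(x := a)) \<phi>) \<longleftrightarrow>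
        (\<exists>a\<in>univ M. sat M ((?t \<circ> e)(x := ?t a)) \<phi>)"
    by (metis transpose_in_univ_iff[OF assms(1) c] transpose_involutory)
  then show ?case
    by (simp only: sat.simps IH)
qed auto

text \<open>Inside a cell that is finite, finitely many predicates do the work of the whole language: it
  suffices to add one separating predicate for each of the finitely many elements that can be
  separated from b.\<close>

lemma finite_cell_stabilizes:
  assumes "finite P" "P \<subseteq> lang M" "finite (cell M P b)"
  obtains Q where "finite Q" "Q \<subseteq> lang M" "cell M Q b = cell M (lang M) b"
proof -
  define D where "D = cell M P b - cell M (lang M) b"
  have "\<forall>x\<in>D. \<exists>p\<in>lang M. (x \<in> interp M p) \<noteq> (b \<in> interp M p)"
    by (auto simp: D_def cell_def)
  then obtain s where s: "\<And>x. x \<in> D \<Longrightarrow> s x \<in> lang M \<and> (x \<in> interp M (s x)) \<noteq> (b \<in> interp M (s x))"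
    by metis
  let ?Q = "P \<union> s ` D"
  have "?Q \<subseteq> lang M"
    using assms(2) s by auto
  moreover have "cell M ?Q b \<subseteq> cell M (lang M) b"
  proof
    fix x assume x: "x \<in> cell M ?Q b"
    then have "x \<notin> D"
      using s by (auto simp: cell_def)
    moreover have "x \<in> cell M P b"
      using x by (auto simp: cell_def)
    ultimately show "x \<in> cell M (lang M) b"
      by (simp add: D_def)
  qed
  ultimately show thesis
    using that[of ?Q] assms(1,3) cell_antimono[of ?Q "lang M" M b] by (auto simp: D_def)
qed

section \<open>Semantic rigidity\<close>

theorem sem_rigid_over_iff:
  "sem_rigid_over M A \<longleftrightarrow> (\<forall>b\<in>univ M - A. cell M (lang M) b \<subseteq> insert b A)"
proof
  assume rigid: "sem_rigid_over M A"
  show "\<forall>b\<in>univ M - A. cell M (lang M) b \<subseteq> insert b A"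
  proof (intro ballI subsetI)
    fix b c assume b: "b \<in> univ M - A" and c: "c \<in> cell M (lang M) b"
    show "c \<in> insert b A"
    proof (rule ccontr)
      assume c_new: "c \<notin> insert b A"
      have "c \<in> univ M"
        using c by (simp add: cell_def)
      then have "bij_betw (transpose b c) (univ M) (univ M)"
        using b by (intro bij_betw_byWitness[where f' = "transpose b c"])
          (auto simp: transpose_in_univ_iff)
      then have "automorphism M (transpose b c)"
        using transpose_in_interp_iff[OF c] by (simp add: automorphism_def)
      moreover have "\<forall>a\<in>A. transpose b c a = a"
        using b c_new by (auto simp: transpose_def)
      ultimately have "transpose b c b = b"
        using rigid b unfolding sem_rigid_over_def by blast
      then show False
        using c_new by simp
    qed
  qed
next
  assume cells: "\<forall>b\<in>univ M - A. cell M (lang M) b \<subseteq> insert b A"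
  show "sem_rigid_over M A"
    unfolding sem_rigid_over_def
  proof (intro allI impI ballI)
    fix f x assume f: "automorphism M f \<and> (\<forall>a\<in>A. f a = a)" and x: "x \<in> univ M"
    show "f x = x"
    proof (rule ccontr)
      assume moved: "f x \<noteq> x"
      have bij: "bij_betw f (univ M) (univ M)"
        using f by (simp add: automorphism_def)
      have fx: "f x \<in> univ M"
        using bij x by (rule bij_betwE[rule_format])
      have "x \<notin> A"
        using moved f by auto
      moreover have "f x \<in> cell M (lang M) x"
        using f x fx by (simp add: cell_def automorphism_def)
      ultimately have "f x \<in> A"
        using cells x moved by blast
      then have "f (f x) = f x"
        using f by simp
      then show False
        using bij_betw_imp_inj_on[OF bij] x fx moved by (auto dest: inj_onD)
    qed
  qed
qed

section \<open>Definable closure\<close>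

abbreviation Conjs :: "'p fm list \<Rightarrow> 'p fm" where
  "Conjs \<phi>s \<equiv> foldr Conj \<phi>s (Eq 0 0)"

lemma sat_Conjs: "sat M e (Conjs \<phi>s) \<longleftrightarrow> (\<forall>\<phi>\<in>set \<phi>s. sat M e \<phi>)"
  by (induction \<phi>s) auto

lemma fv_Conjs: "fv (Conjs \<phi>s) = insert 0 (\<Union>\<phi>\<in>set \<phi>s. fv \<phi>)"
  by (induction \<phi>s) auto

lemma set_fm_Conjs: "set_fm (Conjs \<phi>s) = (\<Union>\<phi>\<in>set \<phi>s. set_fm \<phi>)"
  by (induction \<phi>s) auto

text \<open>This is the source of all definable sets below. The excluded set B is kept separate from A
  because A may be infinite, whereas each excluded element costs one parameter of the formula.\<close>

lemma definable_cell_diff: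
  fixes M :: "('a, 'p) unary_struct"
  assumes "finite P" "P \<subseteq> lang M" "finite B" "B \<subseteq> A"
  shows "definable M A (cell M P b - B)"
proof -
  obtain ps where ps: "set ps = P"
    using finite_list[OF assms(1)] by blast
  obtain xs where xs: "set xs = B"
    using finite_list[OF assms(3)] by blast
  define lits where "lits = map (\<lambda>p. if b \<in> interp M p then Pred p 0 else Neg (Pred p 0)) ps"
  define neqs where "neqs = map (\<lambda>i. Neg (Eq 0 (Suc i)) :: 'p fm) [0..<length xs]"
  define \<phi> where "\<phi> = Conjs (lits @ neqs)"
  \<comment> \<open>Variable 0 is reserved for the defined element, so the parameter list starts at variable 1.\<close>
  define e where "e v = xs ! (v - 1)" for v
  have "set_fm \<phi> \<subseteq> lang M"
    using assms(2) ps by (auto simp: \<phi>_def lits_def neqs_def set_fm_Conjs simp del: foldr_append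
      split: if_splits)
  moreover have "e v \<in> A" if v: "v \<in> fv \<phi> - {0}" for v
  proof -
    have "\<exists>i<length xs. v = Suc i"
      using v by (auto simp: \<phi>_def lits_def neqs_def fv_Conjs simp del: foldr_append
        split: if_splits)
    then show ?thesis
      using xs assms(4) by (auto simp: e_def)
  qed
  moreover have "cell M P b - B = {x \<in> univ M. sat M (e(0 := x)) \<phi>}"
  proof -
    have lits: "(\<forall>\<psi>\<in>set lits. sat M (e(0 := x)) \<psi>) \<longleftrightarrow>
        (\<forall>p\<in>P. x \<in> interp M p \<longleftrightarrow> b \<in> interp M p)" for x
    proof -
      have "(\<forall>\<psi>\<in>set lits. sat M (e(0 := x)) \<psi>) \<longleftrightarrow>
          (\<forall>p\<in>P. sat M (e(0 := x)) (if b \<in> interp M p then Pred p 0 else Neg (Pred p 0)))"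
        unfolding lits_def set_map ps by blast
      also have "\<dots> \<longleftrightarrow> (\<forall>p\<in>P. x \<in> interp M p \<longleftrightarrow> b \<in> interp M p)"
        by (intro ball_cong) auto
      finally show ?thesis .
    qed
    have neqs: "(\<forall>\<psi>\<in>set neqs. sat M (e(0 := x)) \<psi>) \<longleftrightarrow> x \<notin> B" for x
      unfolding xs[symmetric] by (auto simp: neqs_def e_def in_set_conv_nth)
    have "sat M (e(0 := x)) \<phi> \<longleftrightarrow>
        (\<forall>p\<in>P. x \<in> interp M p \<longleftrightarrow> b \<in> interp M p) \<and> x \<notin> B" for x
      unfolding \<phi>_def sat_Conjs set_append ball_Un lits neqs ..
    then show ?thesis
      by (auto simp: cell_def)
  qed
  ultimately show ?thesis
    unfolding definable_def by blast
qed

text \<open>The cell must be finite even though it is only compared with A, because a formula mentions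
  finitely many parameters and so can exclude only finitely many elements of A. Conversely, if the
  cell of the predicates in a formula is infinite or leaves the set \<open>insert b A\<close>,
  then it contains some c that is neither b nor one of the parameters, and the transposition
  of b and c shows that the formula does not isolate b.\<close>

theorem mem_dcl_iff:
  assumes b: "b \<in> univ M" "b \<notin> A"
  shows "b \<in> dcl M A \<longleftrightarrow>
    (\<exists>P. finite P \<and> P \<subseteq> lang M \<and> finite (cell M P b) \<and> cell M P b \<subseteq> insert b A)"
proof
  assume "b \<in> dcl M A"
  then obtain \<phi> e where \<phi>: "set_fm \<phi> \<subseteq> lang M" and e: "\<forall>v\<in>fv \<phi> - {0}. e v \<in> A"
    and def: "{b} = {x \<in> univ M. sat M (e(0 := x)) \<phi>}"
    unfolding dcl_def definable_def by blast
  let ?params = "e ` (fv \<phi> - {0})"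
  have "cell M (set_fm \<phi>) b \<subseteq> insert b ?params"
  proof (rule ccontr)
    assume "\<not> ?thesis"
    then obtain c where c: "c \<in> cell M (set_fm \<phi>) b" "c \<noteq> b" "c \<notin> ?params"
      by blast
    have "sat M (e(0 := b)) \<phi>"
      using def by blast
    then have "sat M (transpose b c \<circ> e(0 := b)) \<phi>"
      using sat_transpose[OF b(1) c(1) subset_refl] by blast
    moreover have "sat M (transpose b c \<circ> e(0 := b)) \<phi> \<longleftrightarrow> sat M (e(0 := c)) \<phi>"
    proof (rule sat_cong)
      fix v assume v: "v \<in> fv \<phi>"
      have "transpose b c (e v) = e v" if "v \<noteq> 0"
      proof (rule transpose_apply_other)
        show "e v \<noteq> b" using that v e b(2) by auto
        show "e v \<noteq> c" using that v c(3) by auto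
      qed
      then show "(transpose b c \<circ> e(0 := b)) v = (e(0 := c)) v"
        by simp
    qed
    ultimately have "c \<in> {b}"
      unfolding def using c(1) by (simp add: cell_def)
    then show False
      using c(2) by simp
  qed
  moreover have "finite (insert b ?params)"
    using finite_fv by blast
  moreover have "?params \<subseteq> A"
    using e by blast
  ultimately show "\<exists>P. finite P \<and> P \<subseteq> lang M \<and> finite (cell M P b) \<and> cell M P b \<subseteq> insert b A"
    using \<phi> finite_set_fm by (metis finite_subset insert_mono order_trans)
next
  assume "\<exists>P. finite P \<and> P \<subseteq> lang M \<and> finite (cell M P b) \<and> cell M P b \<subseteq> insert b A"
  then obtain P where P: "finite P" "P \<subseteq> lang M" "finite (cell M P b)" "cell M P b \<subseteq> insert b A"
    by blast
  have "definable M A (cell M P b - (cell M P b - {b}))"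
    using P by (intro definable_cell_diff) auto
  moreover have "cell M P b - (cell M P b - {b}) = {b}"
    using b by (auto simp: cell_def)
  ultimately show "b \<in> dcl M A"
    using b by (simp add: dcl_def)
qed

lemma param_in_dcl:
  assumes "b \<in> univ M" "b \<in> A"
  shows "b \<in> dcl M A"
proof -
  have "definable M A {b}"
    unfolding definable_def
    by (rule exI[of _ "Eq 0 1"], rule exI[of _ "\<lambda>_. b"]) (use assms in auto)
  then show ?thesis
    using assms by (simp add: dcl_def)
qed

lemma synt_rigid_over_iff_univ_subset_dcl: "synt_rigid_over M A \<longleftrightarrow> univ M \<subseteq> dcl M A"
  unfolding synt_rigid_over_def dcl_def by blast

theorem synt_rigid_over_iff:
  "synt_rigid_over M A \<longleftrightarrow> (\<forall>b\<in>univ M - A. \<exists>P. finite P \<and> P \<subseteq> lang M \<and>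
     finite (cell M P b) \<and> cell M P b \<subseteq> insert b A)"
proof -
  have "synt_rigid_over M A \<longleftrightarrow> (\<forall>b\<in>univ M - A. b \<in> dcl M A)"
    unfolding synt_rigid_over_iff_univ_subset_dcl using param_in_dcl[of _ M A] by blast
  also have "\<dots> \<longleftrightarrow> (\<forall>b\<in>univ M - A. \<exists>P. finite P \<and> P \<subseteq> lang M \<and>
     finite (cell M P b) \<and> cell M P b \<subseteq> insert b A)"
    by (intro ball_cong refl mem_dcl_iff) auto
  finally show ?thesis .
qed

section \<open>Comparing the two notions of rigidity\<close>

lemma synt_rigid_over_imp_sem_rigid_over:
  assumes "synt_rigid_over M A"
  shows "sem_rigid_over M A"
  unfolding sem_rigid_over_iff
proof
  fix b assume "b \<in> univ M - A"
  then obtain P where "P \<subseteq> lang M" "cell M P b \<subseteq> insert b A"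
    using assms unfolding synt_rigid_over_iff by blast
  then show "cell M (lang M) b \<subseteq> insert b A"
    using cell_antimono[of P "lang M" M b] by blast
qed

lemma finite_imp_sem_rigid_over_iff_synt_rigid_over:
  assumes "finite (univ M)"
  shows "sem_rigid_over M A \<longleftrightarrow> synt_rigid_over M A"
proof
  assume sem: "sem_rigid_over M A"
  have fin: "finite (cell M P b)" for P b
    using assms by (simp add: cell_def)
  show "synt_rigid_over M A"
    unfolding synt_rigid_over_iff
  proof
    fix b assume b: "b \<in> univ M - A"
    obtain Q where Q: "finite Q" "Q \<subseteq> lang M" "cell M Q b = cell M (lang M) b"
      by (rule finite_cell_stabilizes[OF finite.emptyI empty_subsetI fin])
    moreover have "cell M Q b \<subseteq> insert b A"
      using sem b unfolding sem_rigid_over_iff Q(3) by simp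
    ultimately show "\<exists>P. finite P \<and> P \<subseteq> lang M \<and> finite (cell M P b) \<and> cell M P b \<subseteq> insert b A"
      using fin[of Q b] by (intro exI[of _ Q]) simp
  qed
qed (rule synt_rigid_over_imp_sem_rigid_over)

text \<open>Semantic rigidity makes the cell of b for the whole language a singleton. If some finite set of
  predicates gave b a finite cell, stabilization would turn this singleton into a cell for
  finitely many predicates, and b would be definable without parameters.\<close>

lemma sem_not_synt_rigid_obtains_avoidable:
  assumes "sem_rigid M" "\<not> synt_rigid M"
  obtains b where "b \<in> univ M" "\<And>A. b \<notin> A \<Longrightarrow> \<not> synt_rigid_over M A"
proof -
  obtain b where b: "b \<in> univ M" "b \<notin> dcl M {}"
    using assms(2) unfolding synt_rigid_over_iff_univ_subset_dcl by blast
  have "infinite (cell M P b)" if P: "finite P" "P \<subseteq> lang M" for P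
  proof
    assume "finite (cell M P b)"
    with P obtain Q where Q: "finite Q" "Q \<subseteq> lang M" "cell M Q b = cell M (lang M) b"
      by (rule finite_cell_stabilizes)
    have "cell M Q b \<subseteq> {b}"
      using assms(1) b(1) unfolding sem_rigid_over_iff Q(3) by simp
    moreover from this have "finite (cell M Q b)"
      by (rule finite_subset) simp
    ultimately show False
      using b(2) Q(1,2) mem_dcl_iff[of b M "{}"] b(1) by blast
  qed
  then have "b \<notin> dcl M A" if "b \<notin> A" for A
    using mem_dcl_iff[OF b(1) that] by blast
  then have "\<not> synt_rigid_over M A" if "b \<notin> A" for A
    using b(1) that unfolding synt_rigid_over_iff_univ_subset_dcl by blast
  then show thesis
    using that[of b] b(1) by simp
qed

lemma not_sem_rigid_obtains_avoidable:
  assumes "\<not> sem_rigid M"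
  obtains b c where "b \<in> univ M" "c \<in> univ M" "b \<noteq> c"
    "\<And>A. b \<notin> A \<Longrightarrow> c \<notin> A \<Longrightarrow> \<not> sem_rigid_over M A"
proof -
  obtain b c where "b \<in> univ M" "c \<in> cell M (lang M) b" "c \<noteq> b"
    using assms unfolding sem_rigid_over_iff by auto
  then show thesis
    using that[of b c] unfolding sem_rigid_over_iff by (auto simp: cell_def)
qed

text \<open>The criterion for semantic rigidity compares pairs of elements outside A, and here there is no
  such pair.\<close>

lemma sem_rigid_over_all_but_one:
  assumes "finite (univ M)" "A \<subseteq> univ M" "card (univ M) = card A + 1"
  shows "sem_rigid_over M A"
proof -
  have "card (univ M - A) = 1"
    using assms by (simp add: card_Diff_subset finite_subset)
  then obtain b where "univ M - A = {b}"
    by (auto simp: card_1_singleton_iff)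
  then show ?thesis
    unfolding sem_rigid_over_iff cell_def by auto
qed

section \<open>Degrees of rigidity\<close>

lemma least_or_infinity_eq_infinity: "(\<And>n. \<not> P n) \<Longrightarrow> least_or_infinity P = \<infinity>"
  by (simp add: least_or_infinity_def)

lemma least_or_infinity_eq_enat:
  assumes "P n" "\<And>k. k < n \<Longrightarrow> \<not> P k"
  shows "least_or_infinity P = enat n"
proof -
  have "(LEAST n. P n) = n"
    using assms by (intro Least_equality) (auto intro: leI)
  then show ?thesis
    using assms(1) by (auto simp: least_or_infinity_def)
qed

lemma least_or_infinity_eq_0: "P 0 \<Longrightarrow> least_or_infinity P = 0"
  using least_or_infinity_eq_enat[of P 0] by (simp add: zero_enat_def)

lemma one_le_least_or_infinity:
  assumes "\<not> P 0"
  shows "1 \<le> least_or_infinity P"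
proof -
  have "1 \<le> (LEAST n. P n)" if "\<exists>n. P n"
  proof -
    have "(LEAST n. P n) \<noteq> 0"
      using LeastI_ex[OF that] assms by metis
    then show ?thesis
      by simp
  qed
  then show ?thesis
    by (simp add: least_or_infinity_def one_enat_def)
qed

lemma least_or_infinity_antimono:
  assumes "\<And>n. Q n \<Longrightarrow> P n"
  shows "least_or_infinity P \<le> least_or_infinity Q"
proof (cases "\<exists>n. Q n")
  case True
  have least: "P (LEAST n. Q n)"
    by (rule assms, rule LeastI_ex[OF True])
  have "\<exists>n. P n"
    using least ..
  moreover have "(LEAST n. P n) \<le> (LEAST n. Q n)"
    using least by (rule Least_le)
  ultimately show ?thesis
    using True by (simp add: least_or_infinity_def)
qed (simp add: least_or_infinity_def)

lemma zero_rigid_iff: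
  fixes M :: "('a, 'p) unary_struct"
  shows "exists_sem_rigid M 0 \<longleftrightarrow> sem_rigid M" "exists_synt_rigid M 0 \<longleftrightarrow> synt_rigid M"
    and "forall_sem_rigid M 0 \<longleftrightarrow> sem_rigid M" "forall_synt_rigid M 0 \<longleftrightarrow> synt_rigid M"
proof -
  have "finite A \<and> card A = 0 \<longleftrightarrow> A = {}" for A :: "'a set"
    by auto
  moreover have "finite A \<and> card A = 0 \<and> R \<longleftrightarrow> A = {} \<and> R" for A :: "'a set" and R
    by auto
  ultimately show
    "exists_sem_rigid M 0 \<longleftrightarrow> sem_rigid M" "exists_synt_rigid M 0 \<longleftrightarrow> synt_rigid M"
    "forall_sem_rigid M 0 \<longleftrightarrow> sem_rigid M" "forall_synt_rigid M 0 \<longleftrightarrow> synt_rigid M"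
    unfolding exists_sem_rigid_def exists_synt_rigid_def forall_sem_rigid_def
      forall_synt_rigid_def by simp_all
qed

lemma forall_synt_rigid_imp_forall_sem_rigid: "forall_synt_rigid M n \<Longrightarrow> forall_sem_rigid M n"
  by (auto simp: forall_synt_rigid_def forall_sem_rigid_def
      intro: synt_rigid_over_imp_sem_rigid_over)

lemma exists_synt_rigid_imp_exists_sem_rigid: "exists_synt_rigid M n \<Longrightarrow> exists_sem_rigid M n"
  by (auto simp: exists_synt_rigid_def exists_sem_rigid_def
      intro: synt_rigid_over_imp_sem_rigid_over)

lemma not_forall_sem_rigid:
  assumes "\<not> sem_rigid M" "infinite (univ M) \<or> n + 2 \<le> card (univ M)"
  shows "\<not> forall_sem_rigid M n"
proof -
  obtain b c where bc: "b \<in> univ M" "c \<in> univ M" "b \<noteq> c"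
    and avoid: "\<And>A. b \<notin> A \<Longrightarrow> c \<notin> A \<Longrightarrow> \<not> sem_rigid_over M A"
    using not_sem_rigid_obtains_avoidable[OF assms(1)] by metis
  have "\<exists>A. finite A \<and> card A = n \<and> A \<subseteq> univ M - {b, c}"
  proof (cases "finite (univ M)")
    case True
    then have "n \<le> card (univ M - {b, c})"
      using assms(2) bc by (simp add: card_Diff_subset)
    then show ?thesis
      by (meson obtain_subset_with_card_n)
  next
    case False
    then show ?thesis
      by (intro infinite_arbitrarily_large) simp
  qed
  then show ?thesis
    using avoid unfolding forall_sem_rigid_def by blast
qed

text \<open>Rigidity fails for a reason that parameters chosen elsewhere cannot repair: one element
  with only infinite cells if M is semantically rigid, and two indistinguishable elements if it
  is not. An infinite universe leaves enough other elements to fill A.\<close>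

lemma not_forall_synt_rigid:
  assumes "infinite (univ M)" "\<not> synt_rigid M"
  shows "\<not> forall_synt_rigid M n"
proof (cases "sem_rigid M")
  case True
  then obtain b where avoid: "\<And>A. b \<notin> A \<Longrightarrow> \<not> synt_rigid_over M A"
    using sem_not_synt_rigid_obtains_avoidable assms(2) by blast
  have "\<exists>A. finite A \<and> card A = n \<and> A \<subseteq> univ M - {b}"
    using assms(1) by (intro infinite_arbitrarily_large) simp
  then show ?thesis
    using avoid unfolding forall_synt_rigid_def by blast
next
  case False
  then show ?thesis
    using assms(1) not_forall_sem_rigid forall_synt_rigid_imp_forall_sem_rigid by blast
qed

text \<open>Both universal degrees are n: all parameters but one always suffice, and fewer leave room
  to avoid two indistinguishable elements. In particular some set of size n suffices, so the
  least size m exists and is at most n; it is positive because M is not rigid.\<close>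

lemma deg4_finite_not_rigid:
  assumes "finite (univ M)" "univ M \<noteq> {}" "\<not> sem_rigid M"
  obtains m n A where "card (univ M) = n + 1" "1 \<le> m" "m \<le> n"
    "A \<subset> univ M" "card A = m" "dcl M A = univ M"
    "\<forall>B. B \<subseteq> univ M \<and> dcl M B = univ M \<longrightarrow> m \<le> card B"
    "deg4 M = (enat m, enat m, enat n, enat n)"
proof -
  define n where "n = card (univ M) - 1"
  have card: "card (univ M) = n + 1"
    using assms(1,2) by (simp add: n_def card_gt_0_iff Suc_leI)
  note sem_iff_synt = finite_imp_sem_rigid_over_iff_synt_rigid_over[OF assms(1)]
  have ex_eq: "exists_sem_rigid M = exists_synt_rigid M"
    by (simp add: fun_eq_iff exists_sem_rigid_def exists_synt_rigid_def sem_iff_synt)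
  have all_eq: "forall_sem_rigid M = forall_synt_rigid M"
    by (simp add: fun_eq_iff forall_sem_rigid_def forall_synt_rigid_def sem_iff_synt)
  have all_n: "forall_sem_rigid M n"
    using sem_rigid_over_all_but_one[OF assms(1)] card by (simp add: forall_sem_rigid_def)
  have all_deg: "least_or_infinity (forall_sem_rigid M) = enat n"
  proof (rule least_or_infinity_eq_enat[of "forall_sem_rigid M", OF all_n])
    fix k assume "k < n"
    then show "\<not> forall_sem_rigid M k"
      using card by (intro not_forall_sem_rigid[OF assms(3)]) simp
  qed
  have "exists_synt_rigid M n"
  proof -
    obtain A where "A \<subseteq> univ M" "card A = n" "finite A"
      using obtain_subset_with_card_n[of n "univ M"] card by auto
    then show ?thesis
      using all_n unfolding all_eq exists_synt_rigid_def forall_synt_rigid_def by blast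
  qed
  define m where "m = (LEAST k. exists_synt_rigid M k)"
  have ex_m: "exists_synt_rigid M m"
    unfolding m_def using \<open>exists_synt_rigid M n\<close> by (rule LeastI)
  have m_le: "m \<le> k" if "exists_synt_rigid M k" for k
    unfolding m_def using that by (rule Least_le)
  have "m \<noteq> 0"
    using ex_m assms(3) unfolding ex_eq[symmetric] by (metis zero_rigid_iff(1))
  obtain A where A: "A \<subseteq> univ M" "card A = m" "dcl M A = univ M"
    using ex_m by (auto simp: exists_synt_rigid_def synt_rigid_over_def)
  have "m \<le> n"
    using m_le \<open>exists_synt_rigid M n\<close> .
  then have "A \<noteq> univ M"
    using A(2) card by auto
  moreover have "\<forall>B. B \<subseteq> univ M \<and> dcl M B = univ M \<longrightarrow> m \<le> card B"
  proof (intro allI impI)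
    fix B assume B: "B \<subseteq> univ M \<and> dcl M B = univ M"
    then have "finite B"
      using assms(1) finite_subset by blast
    then have "exists_synt_rigid M (card B)"
      using B by (auto simp: exists_synt_rigid_def synt_rigid_over_def)
    then show "m \<le> card B"
      by (rule m_le)
  qed
  moreover have "least_or_infinity (exists_synt_rigid M) = enat m"
    using ex_m by (auto simp: least_or_infinity_def m_def)
  then have "deg4 M = (enat m, enat m, enat n, enat n)"
    using all_deg by (simp add: deg4_def ex_eq all_eq)
  ultimately show thesis
    using that[OF card _ \<open>m \<le> n\<close> _ A(2,3)] \<open>m \<noteq> 0\<close> A(1) by (simp add: psubset_eq)
qed

section \<open>The possible tetrads\<close>

theorem corollary2p8:
  fixes M :: "('a, 'p) unary_struct"
  assumes "unary_structure M"
  shows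
    "(sem_rigid M \<and> synt_rigid M \<and> deg4 M = (0, 0, 0, 0)) \<or>
     (\<exists>m n :: nat.
        finite (univ M) \<and> card (univ M) = n + 1 \<and> \<not> sem_rigid M \<and> \<not> synt_rigid M \<and>
        1 \<le> m \<and> m \<le> n \<and>
        (\<exists>A. A \<subset> univ M \<and> card A = m \<and> dcl M A = univ M \<and>
             (\<forall>B. B \<subseteq> univ M \<and> dcl M B = univ M \<longrightarrow> m \<le> card B)) \<and>
        deg4 M = (enat m, enat m, enat n, enat n)) \<or>
     (infinite (univ M) \<and> sem_rigid M \<and> \<not> synt_rigid M \<and>
        (\<exists>\<nu> :: enat. 1 \<le> \<nu> \<and> \<nu> \<le> \<infinity> \<and> deg4 M = (0, \<nu>, 0, \<infinity>))) \<or>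
     (infinite (univ M) \<and> \<not> sem_rigid M \<and> \<not> synt_rigid M \<and>
        (\<exists>\<mu> \<nu> :: enat. 1 \<le> \<mu> \<and> \<mu> \<le> \<nu> \<and> \<nu> \<le> \<infinity> \<and> deg4 M = (\<mu>, \<nu>, \<infinity>, \<infinity>)))"
proof -
  consider (rigid) "synt_rigid M"
    | (fin) "finite (univ M)" "\<not> synt_rigid M"
    | (inf_sem) "infinite (univ M)" "sem_rigid M" "\<not> synt_rigid M"
    | (inf_nonsem) "infinite (univ M)" "\<not> sem_rigid M" "\<not> synt_rigid M"
    by blast
  then show ?thesis
  proof cases
    case rigid
    then have "sem_rigid M"
      by (rule synt_rigid_over_imp_sem_rigid_over)
    with rigid have "deg4 M = (0, 0, 0, 0)"
      by (simp add: deg4_def least_or_infinity_eq_0 zero_rigid_iff)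
    with rigid \<open>sem_rigid M\<close> show ?thesis
      by simp
  next
    case fin
    have nonrigid: "\<not> sem_rigid M"
      using fin finite_imp_sem_rigid_over_iff_synt_rigid_over by blast
    have "univ M \<noteq> {}"
      using assms by (simp add: unary_structure_def)
    then obtain m n A where "card (univ M) = n + 1" "1 \<le> m" "m \<le> n"
      "A \<subset> univ M" "card A = m" "dcl M A = univ M"
      "\<forall>B. B \<subseteq> univ M \<and> dcl M B = univ M \<longrightarrow> m \<le> card B"
      "deg4 M = (enat m, enat m, enat n, enat n)"
      by (rule deg4_finite_not_rigid[OF fin(1) _ nonrigid])
    then show ?thesis
      using fin nonrigid by (intro disjI2[OF disjI1] exI[of _ m] exI[of _ n] exI[of _ A] conjI)
  next
    case inf_sem
    then have "deg4 M = (0, least_or_infinity (exists_synt_rigid M), 0, \<infinity>)"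
      by (simp add: deg4_def least_or_infinity_eq_0 least_or_infinity_eq_infinity
          not_forall_synt_rigid zero_rigid_iff)
    moreover have "1 \<le> least_or_infinity (exists_synt_rigid M)"
      using inf_sem by (simp add: one_le_least_or_infinity zero_rigid_iff)
    ultimately show ?thesis
      using inf_sem by auto
  next
    case inf_nonsem
    let ?\<mu> = "least_or_infinity (exists_sem_rigid M)"
    let ?\<nu> = "least_or_infinity (exists_synt_rigid M)"
    have "deg4 M = (?\<mu>, ?\<nu>, \<infinity>, \<infinity>)"
      using inf_nonsem by (simp add: deg4_def least_or_infinity_eq_infinity
          not_forall_synt_rigid not_forall_sem_rigid)
    moreover have "1 \<le> ?\<mu>"
      using inf_nonsem by (simp add: one_le_least_or_infinity zero_rigid_iff)
    moreover have "?\<mu> \<le> ?\<nu>"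
      by (rule least_or_infinity_antimono) (rule exists_synt_rigid_imp_exists_sem_rigid)
    ultimately show ?thesis
      using inf_nonsem by auto
  qed
qed

end
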